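(* Let $a\in\mathbb{R}$ and let $TI$ be a topological index of one of the two forms $TI(G)=\sum_{v\in V(G)}h(d_v)^a$ with $h:\{1,2,\dots\}\to(0,\infty)$, or $TI(G)=\sum_{uv\in E(G)}f(d_u,d_v)^a$ with $f:\{1,2,\dots\}\times\{1,2,\dots\}\to(0,\infty)$ symmetric. Let $n\ge 2$, let $RSC_n=RSC(n,p_1,p_2,p_3)$ be a random spiro chain, and put $TI_n=TI(RSC_n)$. For $i=1,2,3$ put $TI_{3,i}=TI(RSC_3^i)$ and $\alpha_i=TI_{3,i}-TI_2$, and let $\alpha=\sum_{i=1}^3\alpha_ip_i$ and $\beta=\sum_{i=1}^3\alpha_i^2p_i$. Then $$\mathbb{E}(TI_n)=TI_2+\alpha(n-2),\qquad V(TI_n)=(\beta-\alpha^2)(n-2),$$ where $\mathbb{E}$ and $V$ denote expectation and variance.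
   Context: For a finite simple graph $G$, $V(G)$ and $E(G)$ are its vertex and edge sets and $d_v$ is the degree of the vertex $v$. Random spiro chain. Fix $p_1,p_2,p_3$ with $0<p_i<1$ and $p_1+p_2+p_3=1$. The random spiro chain $RSC_n=RSC(n,p_1,p_2,p_3)$ with $n$ hexagons is built as follows. $RSC_1$ is a hexagon $H_1$ (a 6-cycle). $RSC_2$ consists of two hexagons $H_1,H_2$ sharing exactly one vertex. For $n>2$, $RSC_n$ is obtained from $RSC_{n-1}$ by attaching a new hexagon $H_n$ to the last hexagon $H_{n-1}$, identifying one vertex of $H_n$ with a vertex $w$ of $H_{n-1}$, where $w$ is at distance $i\in\{1,2,3\}$ (in the 6-cycle $H_{n-1}$) from the vertex that $H_{n-1}$ shares with $H_{n-2}$. The resulting graph is denoted $RSC_n^i$. Case $i$ is chosen with probability $p_i$, independently of the previous choices; $L_n\in\{1,2,3\}$ denotes the choice made at step $n$, so $\mathbb{P}(L_n=i)=p_i$. The graph $RSC_2$ and the graphs $RSC_3^1,RSC_3^2,RSC_3^3$ are deterministic (up to isomorphism), so $TI_2$ and $TI_{3,i}$ are constants. *)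

theory Defs
  imports "HOL-Probability.Probability"
begin

record 'a sgraph =
  verts :: "'a set"
  edges :: "'a set set"

definition deg :: "'a sgraph \<Rightarrow> 'a \<Rightarrow> nat" where
  "deg G v = card {e \<in> edges G. v \<in> e}"

(* Least length of a walk from u to v; meaningful when u and v are connected in G. *)
definition gdist :: "'a sgraph \<Rightarrow> 'a \<Rightarrow> 'a \<Rightarrow> nat" where
  "gdist G u v = (LEAST k. (u, v) \<in> {(x, y). {x, y} \<in> edges G} ^^ k)"

definition hexagon :: "'a sgraph \<Rightarrow> bool" where
  "hexagon H \<longleftrightarrow> (\<exists>c :: nat \<Rightarrow> 'a. inj_on c {..<6} \<and> verts H = c ` {..<6} \<and>
     edges H = {{c j, c ((j + 1) mod 6)} | j. j < 6})"

definition chain_graph :: "nat \<Rightarrow> (nat \<Rightarrow> 'a sgraph) \<Rightarrow> 'a sgraph" where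
  "chain_graph n H =
     \<lparr>verts = (\<Union>k\<in>{1..n}. verts (H k)), edges = (\<Union>k\<in>{1..n}. edges (H k))\<rparr>"

(* H 1, ..., H n are the successive hexagons of a spiro chain. The attachment choice l k
   is read only for 3 \<le> k \<le> n. Identifying a vertex of the new hexagon with w is expressed by
   letting the two graphs have exactly the vertex w in common. Vertex names, and which of the
   vertices w at the prescribed distance is used, are left arbitrary. *)
definition spiro_chain :: "nat \<Rightarrow> (nat \<Rightarrow> nat) \<Rightarrow> (nat \<Rightarrow> 'a sgraph) \<Rightarrow> bool" where
  "spiro_chain n l H \<longleftrightarrow>
     (\<forall>k\<in>{1..n}. hexagon (H k)) \<and>
     (2 \<le> n \<longrightarrow> (\<exists>w. verts (H 1) \<inter> verts (H 2) = {w})) \<and>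
     (\<forall>k\<in>{3..n}. \<exists>s w. verts (H (k - 2)) \<inter> verts (H (k - 1)) = {s} \<and>
        w \<in> verts (H (k - 1)) \<and> gdist (H (k - 1)) s w = l k \<and>
        verts (chain_graph (k - 1) H) \<inter> verts (H k) = {w})"

locale random_spiro_chain = prob_space M
  for M :: "'w measure"
    and n :: nat
    and p :: "nat \<Rightarrow> real"
    and L :: "nat \<Rightarrow> 'w \<Rightarrow> nat"
    and H :: "nat \<Rightarrow> 'w \<Rightarrow> 'a sgraph" +
  assumes p_bounds: "\<And>i. i \<in> {1..3} \<Longrightarrow> 0 < p i \<and> p i < 1"
    and p_sum: "(\<Sum>i = 1..3. p i) = 1"
    and choices_indep: "indep_vars (\<lambda>_. count_space {1..3}) L {3..n}"
    and choices_prob: "\<And>k i. k \<in> {3..n} \<Longrightarrow> i \<in> {1..3} \<Longrightarrow>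
          prob {\<omega> \<in> space M. L k \<omega> = i} = p i"
    and chain: "\<And>\<omega>. \<omega> \<in> space M \<Longrightarrow> spiro_chain n (\<lambda>k. L k \<omega>) (\<lambda>k. H k \<omega>)"

definition vertex_index :: "(nat \<Rightarrow> real) \<Rightarrow> real \<Rightarrow> 'a sgraph \<Rightarrow> real" where
  "vertex_index h a G = (\<Sum>v\<in>verts G. h (deg G v) powr a)"

(* The value picked by THE is unique for a symmetric f. *)
definition edge_index :: "(nat \<Rightarrow> nat \<Rightarrow> real) \<Rightarrow> real \<Rightarrow> 'a sgraph \<Rightarrow> real" where
  "edge_index f a G =
     (\<Sum>e\<in>edges G. THE r. \<exists>u v. e = {u, v} \<and> r = f (deg G u) (deg G v) powr a)"

definition topological_index :: "real \<Rightarrow> ('a sgraph \<Rightarrow> real) \<Rightarrow> bool" where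
  "topological_index a TI \<longleftrightarrow>
     (\<exists>h. (\<forall>d\<ge>1. 0 < h d) \<and> TI = vertex_index h a) \<or>
     (\<exists>f. (\<forall>d\<ge>1. \<forall>d'\<ge>1. 0 < f d d' \<and> f d d' = f d' d) \<and> TI = edge_index f a)"

end

theory Submission
  imports Defs
begin

text \<open>Attaching a hexagon to a chain changes a degree-based index by an amount that depends only
  on the attachment choice. The new hexagon \<open>H\<close> meets the chain \<open>G\<close> in a single vertex \<open>w\<close>, which has
  degree 2 in \<open>G\<close> and gets degree 4, while all other degrees stay as they were in \<open>G\<close> or in \<open>H\<close>. For a
  vertex index the increment is therefore a constant. For an edge index, the six new edges contribute
  a constant as well, and among the old edges only the two at \<open>w\<close> change. Their other endpoints are
  vertices of the last hexagon of \<open>G\<close>, where every vertex has degree 2 in \<open>G\<close>, except the vertex \<open>s\<close>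
  at which that hexagon was attached itself, which has degree 4. So the increment depends only on
  whether \<open>s\<close> is a neighbour of \<open>w\<close>, that is, on whether the distance between \<open>s\<close> and \<open>w\<close> is 1.

  Consequently there are a constant \<open>c\<close> and a function \<open>\<delta>\<close> such that the index of every spiro chain
  with \<open>n\<close> hexagons and choices \<open>l 3, \<dots>, l n\<close> is \<open>c + \<delta> (l 3) + \<dots> + \<delta> (l n)\<close>
  (\<open>topological_index_spiro_chain\<close>). The cases \<open>n = 2\<close> and \<open>n = 3\<close> identify \<open>c\<close> with the index of the
  chain of two hexagons and \<open>\<delta> i\<close> with \<open>\<alpha>\<^sub>i\<close>. Hence the index of the random chain is a constant plus a
  sum of \<open>n - 2\<close> independent random variables. Each of them is \<open>\<alpha>\<^sub>i\<close> on the event, of probability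
  \<open>p\<^sub>i\<close>, that the choice is \<open>i\<close>, so it has mean \<open>\<alpha>\<close> and variance \<open>\<beta> - \<alpha>\<^sup>2\<close>.\<close>

section \<open>Variance of sums of independent random variables\<close>

lemma (in prob_space) variance_add_indep:
  fixes X Y :: "'a \<Rightarrow> real"
  assumes indep: "indep_var borel X borel Y"
    and X: "integrable M X" "integrable M (\<lambda>x. (X x)\<^sup>2)"
    and Y: "integrable M Y" "integrable M (\<lambda>x. (Y x)\<^sup>2)"
  shows "integrable M (\<lambda>x. (X x + Y x)\<^sup>2)"
    and "variance (\<lambda>x. X x + Y x) = variance X + variance Y"
proof -
  note prod = indep_var_integrable[OF indep X(1) Y(1)] indep_var_lebesgue_integral[OF indep X(1) Y(1)]
  have sq: "(\<lambda>x. (X x + Y x)\<^sup>2) = (\<lambda>x. (X x)\<^sup>2 + (Y x)\<^sup>2 + 2 * (X x * Y x))"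
    by (auto simp: power2_sum)
  show int: "integrable M (\<lambda>x. (X x + Y x)\<^sup>2)"
    unfolding sq using X Y prod by simp
  have "expectation (\<lambda>x. (X x + Y x)\<^sup>2)
      = expectation (\<lambda>x. (X x)\<^sup>2) + expectation (\<lambda>x. (Y x)\<^sup>2) + 2 * (expectation X * expectation Y)"
    unfolding sq using X Y prod by simp
  moreover have "expectation (\<lambda>x. X x + Y x) = expectation X + expectation Y"
    using X Y by simp
  moreover have "variance (\<lambda>x. X x + Y x)
      = expectation (\<lambda>x. (X x + Y x)\<^sup>2) - (expectation (\<lambda>x. X x + Y x))\<^sup>2"
    using X Y int by (intro variance_eq) auto
  ultimately show "variance (\<lambda>x. X x + Y x) = variance X + variance Y"
    using X Y by (simp add: variance_eq power2_sum)
qed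

text \<open>Each step of the induction adds one summand to a sum that is independent of it; the square of
  the partial sum has to be shown integrable along the way.\<close>

lemma (in prob_space) variance_sum_indep:
  fixes X :: "'i \<Rightarrow> 'a \<Rightarrow> real"
  assumes "finite I" "indep_vars (\<lambda>_. borel) X I"
    and "\<And>i. i \<in> I \<Longrightarrow> integrable M (X i)"
    and "\<And>i. i \<in> I \<Longrightarrow> integrable M (\<lambda>x. (X i x)\<^sup>2)"
  shows "variance (\<lambda>x. \<Sum>i\<in>I. X i x) = (\<Sum>i\<in>I. variance (X i))"
proof -
  have "integrable M (\<lambda>x. (\<Sum>i\<in>I. X i x)\<^sup>2) \<and>
      variance (\<lambda>x. \<Sum>i\<in>I. X i x) = (\<Sum>i\<in>I. variance (X i))"
    using assms
  proof (induction I rule: finite_induct)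
    case (insert j J)
    have "indep_vars (\<lambda>_. borel) X J"
      using insert.prems(1) by (rule indep_vars_subset) auto
    with insert have IH: "integrable M (\<lambda>x. (\<Sum>i\<in>J. X i x)\<^sup>2)"
        "variance (\<lambda>x. \<Sum>i\<in>J. X i x) = (\<Sum>i\<in>J. variance (X i))"
      by auto
    have int: "integrable M (\<lambda>x. \<Sum>i\<in>J. X i x)"
      using insert.prems by (intro Bochner_Integration.integrable_sum) auto
    note add = variance_add_indep[OF indep_vars_sum[OF insert.hyps insert.prems(1)] _ _ int IH(1)]
    show ?case
      using add insert.hyps insert.prems(2,3) IH(2) by simp
  qed simp
  then show ?thesis ..
qed

section \<open>Random variables with finitely many values\<close>

text \<open>As \<open>S\<close> is finite, \<open>F \<circ> X\<close> is a linear combination of indicators of the events \<open>X = i\<close>.\<close>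

lemma (in prob_space) finite_valued_distribution:
  fixes F :: "'i \<Rightarrow> real"
  assumes "finite S" and X: "X \<in> measurable M (count_space S)"
    and p: "\<And>i. i \<in> S \<Longrightarrow> prob {\<omega> \<in> space M. X \<omega> = i} = p i"
  shows "integrable M (\<lambda>\<omega>. F (X \<omega>))"
    and "expectation (\<lambda>\<omega>. F (X \<omega>)) = (\<Sum>i\<in>S. F i * p i)"
proof -
  define E where "E i = {\<omega> \<in> space M. X \<omega> = i}" for i
  have E: "E i \<in> events" if "i \<in> S" for i
  proof -
    have "E i = X -` {i} \<inter> space M" by (auto simp: E_def)
    then show ?thesis using measurable_sets[OF X, of "{i}"] that by simp
  qed
  have decomp: "F (X \<omega>) = (\<Sum>i\<in>S. F i * indicator (E i) \<omega>)" if "\<omega> \<in> space M" for \<omega>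
  proof -
    have "X \<omega> \<in> S" using measurable_space[OF X that] by simp
    have "(\<Sum>i\<in>S. F i * indicator (E i) \<omega>) = (\<Sum>i\<in>S. if X \<omega> = i then F i else 0)"
      using that by (intro sum.cong) (auto simp: E_def)
    also have "\<dots> = F (X \<omega>)"
      using \<open>finite S\<close> \<open>X \<omega> \<in> S\<close> by simp
    finally show ?thesis ..
  qed
  have int: "integrable M (\<lambda>\<omega>. F i * indicator (E i) \<omega> :: real)" if "i \<in> S" for i
    using E[OF that] by (simp add: emeasure_eq_measure)
  have "integrable M (\<lambda>\<omega>. \<Sum>i\<in>S. F i * indicator (E i) \<omega>)"
    using int by (rule Bochner_Integration.integrable_sum)
  then show "integrable M (\<lambda>\<omega>. F (X \<omega>))"
    by (rule Bochner_Integration.integrable_cong[THEN iffD2, rotated 2]) (simp_all add: decomp)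
  have "expectation (\<lambda>\<omega>. F (X \<omega>)) = expectation (\<lambda>\<omega>. \<Sum>i\<in>S. F i * indicator (E i) \<omega>)"
    using decomp by (rule Bochner_Integration.integral_cong[OF refl])
  also have "\<dots> = (\<Sum>i\<in>S. expectation (\<lambda>\<omega>. F i * indicator (E i) \<omega>))"
    using int by (rule Bochner_Integration.integral_sum)
  also have "\<dots> = (\<Sum>i\<in>S. F i * p i)"
    using E p by (intro sum.cong) (auto simp: E_def Int_absorb2)
  finally show "expectation (\<lambda>\<omega>. F (X \<omega>)) = (\<Sum>i\<in>S. F i * p i)" .
qed

section \<open>Simple graphs and their union\<close>

definition simple_graph :: "'a sgraph \<Rightarrow> bool" where
  "simple_graph G \<longleftrightarrow> finite (verts G) \<and> (\<forall>e\<in>edges G. e \<subseteq> verts G \<and> card e = 2)"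

definition nbrs :: "'a sgraph \<Rightarrow> 'a \<Rightarrow> 'a set" where
  "nbrs G v = {u. {v, u} \<in> edges G}"

definition graph_join :: "'a sgraph \<Rightarrow> 'a sgraph \<Rightarrow> 'a sgraph" where
  "graph_join G H = \<lparr>verts = verts G \<union> verts H, edges = edges G \<union> edges H\<rparr>"

lemma simple_graph_finite_edges: "simple_graph G \<Longrightarrow> finite (edges G)"
  unfolding simple_graph_def by (metis Pow_iff finite_Pow_iff finite_subset subsetI)

lemma simple_graph_edgeD:
  assumes "simple_graph G" "{u, v} \<in> edges G"
  shows "u \<in> verts G" "v \<in> verts G" "u \<noteq> v"
  using assms by (force simp: simple_graph_def)+

lemma simple_graph_edgeE:
  assumes "simple_graph G" "e \<in> edges G" "u \<in> e"
  obtains v where "e = {u, v}"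
  using assms unfolding simple_graph_def card_2_iff by (metis insertE insert_commute singletonD)

text \<open>Edges at \<open>v\<close> correspond to neighbours of \<open>v\<close>. Degrees count the former, but the sums below run
  over the latter.\<close>

lemma incident_edges: "simple_graph G \<Longrightarrow> {e \<in> edges G. v \<in> e} = (\<lambda>u. {v, u}) ` nbrs G v"
  by (auto simp: nbrs_def elim: simple_graph_edgeE)

lemma inj_on_pair: "inj_on (\<lambda>u. {v, u}) A"
  by (auto simp: inj_on_def doubleton_eq_iff)

lemma deg_eq_card_nbrs: "simple_graph G \<Longrightarrow> deg G v = card (nbrs G v)"
  unfolding deg_def by (simp add: incident_edges card_image[OF inj_on_pair])

lemma nbrs_subset: "simple_graph G \<Longrightarrow> nbrs G v \<subseteq> verts G"
  using simple_graph_edgeD by (fastforce simp: nbrs_def)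

lemma nbrs_eq_empty: "simple_graph G \<Longrightarrow> v \<notin> verts G \<Longrightarrow> nbrs G v = {}"
  using simple_graph_edgeD(1) by (fastforce simp: nbrs_def)

lemma deg_pos: "simple_graph G \<Longrightarrow> {u, v} \<in> edges G \<Longrightarrow> deg G u \<ge> 1"
  using simple_graph_finite_edges[of G] by (auto simp: deg_def Suc_le_eq card_gt_0_iff)

lemma simple_graph_join: "simple_graph G \<Longrightarrow> simple_graph H \<Longrightarrow> simple_graph (graph_join G H)"
  by (auto simp: simple_graph_def graph_join_def)

text \<open>An edge has two endpoints, so it does not fit into a single common vertex.\<close>

lemma edges_disjoint:
  assumes "simple_graph G" "simple_graph H" "verts G \<inter> verts H = {w}"
  shows "edges G \<inter> edges H = {}"
proof (intro equals0I)
  fix e assume "e \<in> edges G \<inter> edges H"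
  then have "e \<subseteq> {w}" "card e = 2"
    using assms unfolding simple_graph_def by blast+
  then show False
    using card_mono[of "{w}" e] by simp
qed

lemma deg_join:
  assumes G: "simple_graph G" and H: "simple_graph H" and w: "verts G \<inter> verts H = {w}"
  shows "deg (graph_join G H) v = deg G v + deg H v"
proof -
  have "{e \<in> edges (graph_join G H). v \<in> e} = {e \<in> edges G. v \<in> e} \<union> {e \<in> edges H. v \<in> e}"
    by (auto simp: graph_join_def)
  then show ?thesis
    using simple_graph_finite_edges[OF G] simple_graph_finite_edges[OF H]
      edges_disjoint[OF assms]
    by (auto simp: deg_def intro!: card_Un_disjoint)
qed

lemma deg_eq_0: "simple_graph G \<Longrightarrow> v \<notin> verts G \<Longrightarrow> deg G v = 0"
  by (simp add: deg_eq_card_nbrs nbrs_eq_empty)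

section \<open>Hexagons\<close>

lemma hexagonE:
  assumes "hexagon H"
  obtains a b c d e f where "distinct [a, b, c, d, e, f]" "verts H = {a, b, c, d, e, f}"
    "edges H = {{a, b}, {b, c}, {c, d}, {d, e}, {e, f}, {f, a}}"
proof -
  obtain c :: "nat \<Rightarrow> 'a" where inj: "inj_on c {..<6}" and V: "verts H = c ` {..<6}"
    and E: "edges H = {{c j, c ((j + 1) mod 6)} | j. j < 6}"
    using assms unfolding hexagon_def by blast
  have six: "{..<6} = {0, 1, 2, 3, 4, 5 :: nat}" by auto
  have succ: "(0 + 1) mod 6 = (1 :: nat)" "(1 + 1) mod 6 = (2 :: nat)" "(2 + 1) mod 6 = (3 :: nat)"
    "(3 + 1) mod 6 = (4 :: nat)" "(4 + 1) mod 6 = (5 :: nat)" "(5 + 1) mod 6 = (0 :: nat)"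
    by simp_all
  have E': "edges H = (\<lambda>j. {c j, c ((j + 1) mod 6)}) ` {..<6}"
    unfolding E by auto
  show ?thesis
  proof
    show "distinct [c 0, c 1, c 2, c 3, c 4, c 5]"
      using inj by (auto simp: six inj_on_def)
    show "verts H = {c 0, c 1, c 2, c 3, c 4, c 5}"
      unfolding V six by simp
    show "edges H = {{c 0, c 1}, {c 1, c 2}, {c 2, c 3}, {c 3, c 4}, {c 4, c 5}, {c 5, c 0}}"
      by (simp only: E' six image_insert image_empty succ)
  qed
qed

lemma hexagon_simple:
  assumes "hexagon H"
  shows "simple_graph H"
  using assms by (rule hexagonE) (auto simp: simple_graph_def)

lemma hexagon_card:
  assumes "hexagon H"
  shows "card (verts H) = 6" "card (edges H) = 6"
  using assms by (rule hexagonE, auto simp: doubleton_eq_iff)+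

lemma hexagon_deg:
  assumes "hexagon H" "v \<in> verts H"
  shows "deg H v = 2"
  using assms(1)
proof (rule hexagonE)
  fix a b c d e f
  assume *: "distinct [a, b, c, d, e, f]" "verts H = {a, b, c, d, e, f}"
    "edges H = {{a, b}, {b, c}, {c, d}, {d, e}, {e, f}, {f, a}}"
  have "nbrs H a = {b, f}" "nbrs H b = {a, c}" "nbrs H c = {b, d}" "nbrs H d = {c, e}"
    "nbrs H e = {d, f}" "nbrs H f = {e, a}"
    using *(1) unfolding nbrs_def *(3) by (auto simp: doubleton_eq_iff)
  then show ?thesis
    using assms(2) * by (auto simp: deg_eq_card_nbrs[OF hexagon_simple[OF assms(1)]])
qed

lemma hexagon_connected:
  assumes "hexagon H" "u \<in> verts H" "v \<in> verts H"
  shows "(u, v) \<in> {(x, y). {x, y} \<in> edges H}\<^sup>*" (is "_ \<in> ?R\<^sup>*")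
  using assms(1)
proof (rule hexagonE)
  fix a b c d e f
  assume V: "verts H = {a, b, c, d, e, f}"
    and E: "edges H = {{a, b}, {b, c}, {c, d}, {d, e}, {e, f}, {f, a}}"
  have "sym ?R" by (auto simp: sym_def insert_commute)
  then have "sym (?R\<^sup>*)" by (rule sym_rtrancl)
  have step: "(a, y) \<in> ?R\<^sup>*" if "(a, x) \<in> ?R\<^sup>*" "{x, y} \<in> edges H" for x y
    using that by (auto intro: rtrancl_into_rtrancl)
  have b: "(a, b) \<in> ?R\<^sup>*" by (rule step[of a]) (auto simp: E)
  have c: "(a, c) \<in> ?R\<^sup>*" by (rule step[OF b]) (auto simp: E)
  have d: "(a, d) \<in> ?R\<^sup>*" by (rule step[OF c]) (auto simp: E)
  have e: "(a, e) \<in> ?R\<^sup>*" by (rule step[OF d]) (auto simp: E)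
  have f: "(a, f) \<in> ?R\<^sup>*" by (rule step[OF e]) (auto simp: E)
  have "(a, x) \<in> ?R\<^sup>*" if "x \<in> verts H" for x
    using that b c d e f by (auto simp: V)
  then show ?thesis
    using assms \<open>sym (?R\<^sup>*)\<close> by (meson rtrancl_trans symD)
qed

text \<open>Connectedness matters for the direction from left to right: without a walk from \<open>u\<close> to \<open>v\<close>,
  \<open>gdist\<close> is the least element of an empty set of lengths, about which nothing is known.\<close>

lemma hexagon_gdist_eq_1:
  assumes "hexagon H" "u \<in> verts H" "v \<in> verts H"
  shows "gdist H u v = 1 \<longleftrightarrow> {u, v} \<in> edges H"
proof
  let ?R = "{(x, y). {x, y} \<in> edges H}"
  obtain k where "(u, v) \<in> ?R ^^ k"
    using hexagon_connected[OF assms] rtrancl_imp_relpow by blast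
  then have "(u, v) \<in> ?R ^^ gdist H u v"
    unfolding gdist_def by (rule LeastI)
  moreover assume "gdist H u v = 1"
  ultimately show "{u, v} \<in> edges H" by simp
next
  assume "{u, v} \<in> edges H"
  then show "gdist H u v = 1"
    using simple_graph_edgeD(3)[OF hexagon_simple[OF assms(1)]]
    unfolding gdist_def by (intro Least_equality) (auto simp: Suc_le_eq intro: gr0I)
qed

lemma gdist_refl: "gdist G v v = 0"
  unfolding gdist_def by (rule Least_equality) auto

section \<open>Effect of attaching a hexagon on an index\<close>

text \<open>Five new vertices of degree 2 appear, and \<open>w\<close> changes its degree from 2 to 4.\<close>

lemma vertex_index_join:
  assumes G: "simple_graph G" and H: "hexagon H" and w: "verts G \<inter> verts H = {w}"
    and deg_w: "deg G w = 2"
  shows "vertex_index h a (graph_join G H) = vertex_index h a G + 4 * h 2 powr a + h 4 powr a"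
proof -
  note H' = hexagon_simple[OF H]
  note deg = deg_join[OF G H' w]
  let ?J = "graph_join G H" and ?t = "\<lambda>v. h (deg (graph_join G H) v) powr a"
  have fin: "finite (verts G)" "finite (verts H)" and mem: "w \<in> verts G" "w \<in> verts H"
    using G H' w by (auto simp: simple_graph_def)
  have only_w: "v \<notin> verts H" if "v \<in> verts G" "v \<noteq> w" for v
    using w that by blast
  have only_w': "v \<notin> verts G" if "v \<in> verts H" "v \<noteq> w" for v
    using w that by blast
  have verts_J: "verts ?J = insert w ((verts G - {w}) \<union> (verts H - {w}))"
    using mem by (auto simp: graph_join_def)
  have "sum ?t (verts ?J) = ?t w + (sum ?t (verts G - {w}) + sum ?t (verts H - {w}))"
    unfolding verts_J using fin w by (subst sum.insert) (auto intro!: sum.union_disjoint)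
  also have "?t w = h 4 powr a"
    using deg deg_w hexagon_deg[OF H] mem by simp
  also have "sum ?t (verts G - {w}) = (\<Sum>v\<in>verts G - {w}. h (deg G v) powr a)"
    using only_w by (intro sum.cong) (simp_all add: deg deg_eq_0[OF H'])
  also have "\<dots> = vertex_index h a G - h 2 powr a"
    using fin mem deg_w by (simp add: vertex_index_def sum_diff1)
  also have "sum ?t (verts H - {w}) = (\<Sum>v\<in>verts H - {w}. h 2 powr a)"
    using only_w' by (intro sum.cong) (simp_all add: deg hexagon_deg[OF H] deg_eq_0[OF G] numeral_2_eq_2)
  also have "\<dots> = 5 * h 2 powr a"
    using fin mem hexagon_card[OF H] by simp
  finally show ?thesis by (simp add: vertex_index_def)
qed

definition edge_term :: "(nat \<Rightarrow> nat \<Rightarrow> real) \<Rightarrow> real \<Rightarrow> 'a sgraph \<Rightarrow> 'a set \<Rightarrow> real" where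
  "edge_term f a G e = (THE r. \<exists>u v. e = {u, v} \<and> r = f (deg G u) (deg G v) powr a)"

lemma edge_index_eq: "edge_index f a G = (\<Sum>e\<in>edges G. edge_term f a G e)"
  by (simp add: edge_index_def edge_term_def)

text \<open>The symmetry of \<open>f\<close> is known only for positive arguments. That suffices, as the endpoints of an
  edge have positive degree.\<close>

lemma edge_term_pair:
  assumes "simple_graph G" "{u, v} \<in> edges G"
    and sym: "\<And>d d'. d \<ge> 1 \<Longrightarrow> d' \<ge> 1 \<Longrightarrow> f d d' = f d' d"
  shows "edge_term f a G {u, v} = f (deg G u) (deg G v) powr a"
proof -
  have "f (deg G u) (deg G v) = f (deg G v) (deg G u)"
    using assms deg_pos[of G u v] deg_pos[of G v u] by (auto simp: insert_commute)
  then show ?thesis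
    unfolding edge_term_def by (intro the_equality) (auto simp: doubleton_eq_iff)
qed

text \<open>Of the six new edges, the two at \<open>w\<close> join degrees 2 and 4, and the other four join two vertices
  of degree 2. The old edges that change are those at \<open>w\<close>; the last sum lists them by their other
  endpoint.\<close>

lemma edge_index_join:
  assumes G: "simple_graph G" and H: "hexagon H" and w: "verts G \<inter> verts H = {w}"
    and deg_w: "deg G w = 2"
    and sym: "\<And>d d'. d \<ge> 1 \<Longrightarrow> d' \<ge> 1 \<Longrightarrow> f d d' = f d' d"
  shows "edge_index f a (graph_join G H) = edge_index f a G
      + (4 * f 2 2 powr a + 2 * f 2 4 powr a)
      + (\<Sum>u\<in>nbrs G w. f 4 (deg G u) powr a - f 2 (deg G u) powr a)"
proof -
  note H' = hexagon_simple[OF H]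
  note deg = deg_join[OF G H' w]
  note term_pair = edge_term_pair[where f = f and a = a, OF _ _ sym]
  define J where "J = graph_join G H"
  note simple_J = simple_graph_join[OF G H', folded J_def] and deg_J = deg[folded J_def]
  have sub: "edges G \<subseteq> edges J" "edges H \<subseteq> edges J"
    by (auto simp: J_def graph_join_def)
  have fin: "finite (edges G)" "finite (edges H)" and mem: "w \<in> verts G" "w \<in> verts H"
    using simple_graph_finite_edges G H' w by auto
  let ?T = "edge_term f a J"
  have dw: "deg J w = 4"
    using deg_J deg_w hexagon_deg[OF H] mem by simp
  have only_w: "v \<notin> verts H" if "v \<in> verts G" "v \<noteq> w" for v
    using w that by blast
  have only_w': "v \<notin> verts G" if "v \<in> verts H" "v \<noteq> w" for v
    using w that by blast
  have dG: "deg J v = deg G v" if "v \<in> verts G" "v \<noteq> w" for v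
    using that only_w by (simp add: deg_J deg_eq_0[OF H'])
  have dH: "deg J v = 2" if "v \<in> verts H" "v \<noteq> w" for v
    using that only_w' by (simp add: deg_J hexagon_deg[OF H] deg_eq_0[OF G])
  have f42: "f 4 2 = f 2 4"
    by (rule sym) auto
  have H_at: "?T e = f 2 4 powr a" if "e \<in> edges H" "w \<in> e" for e
  proof -
    obtain u where e: "e = {w, u}"
      using H' \<open>e \<in> edges H\<close> \<open>w \<in> e\<close> by (rule simple_graph_edgeE)
    with that have "u \<in> verts H" "u \<noteq> w"
      using simple_graph_edgeD[OF H'] by blast+
    moreover have "{w, u} \<in> edges J" using that sub e by blast
    ultimately show ?thesis
      using dH dw f42 by (simp add: e term_pair[OF simple_J])
  qed
  have H_off: "?T e = f 2 2 powr a" if "e \<in> edges H" "w \<notin> e" for e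
  proof -
    have "card e = 2" using H' that by (auto simp: simple_graph_def)
    then obtain u v where e: "e = {u, v}" by (auto simp: card_2_iff)
    with that have "u \<in> verts H" "u \<noteq> w" "v \<in> verts H" "v \<noteq> w"
      using simple_graph_edgeD[OF H'] by blast+
    moreover have "{u, v} \<in> edges J" using that sub e by blast
    ultimately show ?thesis
      using dH by (simp add: e term_pair[OF simple_J])
  qed
  have G_off: "?T e = edge_term f a G e" if "e \<in> edges G" "w \<notin> e" for e
  proof -
    have "card e = 2" using G that by (auto simp: simple_graph_def)
    then obtain u v where e: "e = {u, v}" by (auto simp: card_2_iff)
    with that have "u \<in> verts G" "u \<noteq> w" "v \<in> verts G" "v \<noteq> w"
      using simple_graph_edgeD[OF G] by blast+
    moreover have "{u, v} \<in> edges G" "{u, v} \<in> edges J" using that sub e by blast+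
    ultimately show ?thesis
      using dG by (simp add: e term_pair[OF simple_J] term_pair[OF G])
  qed
  have G_at: "?T {w, u} - edge_term f a G {w, u} = f 4 (deg G u) powr a - f 2 (deg G u) powr a"
    if "u \<in> nbrs G w" for u
  proof -
    have e: "{w, u} \<in> edges G" using that by (simp add: nbrs_def)
    then have "u \<in> verts G" "u \<noteq> w"
      using simple_graph_edgeD[OF G] by blast+
    moreover have "{w, u} \<in> edges J" using e sub by auto
    ultimately show ?thesis
      using dG dw deg_w by (simp add: term_pair[OF simple_J] term_pair[OF G e])
  qed
  have "edge_index f a J = sum ?T (edges G) + sum ?T (edges H)"
    unfolding edge_index_eq using fin edges_disjoint[OF G H' w]
    by (simp add: J_def graph_join_def sum.union_disjoint)
  also have "sum ?T (edges H) = 2 * f 2 4 powr a + 4 * f 2 2 powr a"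
  proof -
    let ?A = "{e \<in> edges H. w \<in> e}"
    have "card ?A = 2" using hexagon_deg[OF H] mem by (simp add: deg_def)
    moreover have "card (edges H - ?A) = 4"
      using \<open>card ?A = 2\<close> fin hexagon_card[OF H] by (subst card_Diff_subset) auto
    moreover have "sum ?T ?A = (\<Sum>e\<in>?A. f 2 4 powr a)"
      using H_at by (intro sum.cong) auto
    moreover have "sum ?T (edges H - ?A) = (\<Sum>e\<in>edges H - ?A. f 2 2 powr a)"
      using H_off by (intro sum.cong) auto
    moreover have "sum ?T (edges H) = sum ?T (edges H - ?A) + sum ?T ?A"
      using fin by (intro sum.subset_diff) auto
    ultimately show ?thesis by simp
  qed
  also have "sum ?T (edges G) = edge_index f a G + (\<Sum>e\<in>edges G. ?T e - edge_term f a G e)"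
    by (simp add: edge_index_eq sum_subtractf)
  also have "(\<Sum>e\<in>edges G. ?T e - edge_term f a G e)
      = (\<Sum>e\<in>{e \<in> edges G. w \<in> e}. ?T e - edge_term f a G e)"
    using fin G_off by (intro sum.mono_neutral_right) auto
  also have "\<dots> = (\<Sum>u\<in>nbrs G w. ?T {w, u} - edge_term f a G {w, u})"
    unfolding incident_edges[OF G] by (simp add: sum.reindex[OF inj_on_pair])
  also have "\<dots> = (\<Sum>u\<in>nbrs G w. f 4 (deg G u) powr a - f 2 (deg G u) powr a)"
    using G_at by (rule sum.cong[OF refl])
  finally show ?thesis by (simp add: J_def)
qed


lemma vertex_index_hexagon: "hexagon H \<Longrightarrow> vertex_index h a H = 6 * h 2 powr a"
  using hexagon_card(1)[of H] by (simp add: vertex_index_def hexagon_deg)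

lemma edge_index_hexagon:
  assumes H: "hexagon H" and sym: "\<And>d d'. d \<ge> 1 \<Longrightarrow> d' \<ge> 1 \<Longrightarrow> f d d' = f d' d"
  shows "edge_index f a H = 6 * f 2 2 powr a"
proof -
  have "edge_term f a H e = f 2 2 powr a" if e: "e \<in> edges H" for e
  proof -
    obtain u v where "e = {u, v}"
      using e hexagon_simple[OF H] by (auto simp: simple_graph_def card_2_iff)
    moreover from this have "deg H u = 2" "deg H v = 2"
      using e simple_graph_edgeD[OF hexagon_simple[OF H], of u v] hexagon_deg[OF H] by auto
    ultimately show ?thesis
      using e edge_term_pair[OF hexagon_simple[OF H], of u v f a, OF _ sym] by simp
  qed
  then show ?thesis
    using hexagon_card(2)[OF H] by (simp add: edge_index_eq)
qed

section \<open>Structure of spiro chains\<close>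

lemma chain_graph_1: "chain_graph 1 H = H 1"
  by (simp add: chain_graph_def)

lemma chain_graph_Suc: "k \<ge> 1 \<Longrightarrow> chain_graph (Suc k) H = graph_join (chain_graph k H) (H (Suc k))"
  by (auto simp: chain_graph_def graph_join_def atLeastAtMostSuc_conv)

lemma chain_graph_pred: "2 \<le> k \<Longrightarrow> chain_graph k H = graph_join (chain_graph (k - 1) H) (H k)"
  using chain_graph_Suc[of "k - 1" H] by (cases k) auto

lemma spiro_chain_hexagon: "spiro_chain n l H \<Longrightarrow> k \<in> {1..n} \<Longrightarrow> hexagon (H k)"
  by (simp add: spiro_chain_def)

lemma simple_graph_chain:
  assumes "spiro_chain n l H" "1 \<le> k" "k \<le> n"
  shows "simple_graph (chain_graph k H)"
  using assms(2,3)
proof (induction k rule: dec_induct)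
  case base
  then have "hexagon (H 1)"
    using spiro_chain_hexagon[OF assms(1)] by simp
  then show ?case
    unfolding chain_graph_1 by (rule hexagon_simple)
next
  case (step k)
  then show ?case
    using hexagon_simple[OF spiro_chain_hexagon[OF assms(1), of "Suc k"]]
    by (simp add: chain_graph_Suc simple_graph_join)
qed

text \<open>The defining condition of a spiro chain measures the distance from the vertex shared by the two
  preceding hexagons. If the hexagon \<open>H k\<close> meets the whole earlier chain in the single vertex \<open>s\<close> of
  \<open>H (k - 1)\<close>, that shared vertex is \<open>s\<close>. As the distance is positive, the next attachment vertex
  differs from \<open>s\<close>, hence belongs to no hexagon before \<open>H k\<close>.\<close>

lemma next_attachment:
  assumes chain: "spiro_chain n l H" and l: "\<forall>k\<in>{3..n}. l k \<noteq> 0"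
    and k: "2 \<le> k" "Suc k \<le> n"
    and s: "verts (chain_graph (k - 1) H) \<inter> verts (H k) = {s}" "s \<in> verts (H (k - 1))"
  obtains w where "w \<in> verts (H k)" "w \<notin> verts (chain_graph (k - 1) H)"
    "gdist (H k) s w = l (Suc k)" "verts (chain_graph k H) \<inter> verts (H (Suc k)) = {w}"
proof -
  have "Suc k \<in> {3..n}" using k by auto
  then have "\<exists>s w. verts (H (Suc k - 2)) \<inter> verts (H (Suc k - 1)) = {s} \<and>
      w \<in> verts (H (Suc k - 1)) \<and> gdist (H (Suc k - 1)) s w = l (Suc k) \<and>
      verts (chain_graph (Suc k - 1) H) \<inter> verts (H (Suc k)) = {w}"
    using chain unfolding spiro_chain_def by blast
  then obtain s' w where w: "verts (H (k - 1)) \<inter> verts (H k) = {s'}" "w \<in> verts (H k)"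
      "gdist (H k) s' w = l (Suc k)" "verts (chain_graph k H) \<inter> verts (H (Suc k)) = {w}"
    by (auto simp: numeral_2_eq_2)
  have "s \<in> verts (H k)"
    using s(1) by (metis IntD2 insertI1)
  then have "s \<in> verts (H (k - 1)) \<inter> verts (H k)"
    using s(2) by simp
  then have "s' = s"
    unfolding w(1) by simp
  have "l (Suc k) \<noteq> 0"
    using l \<open>Suc k \<in> {3..n}\<close> by blast
  then have "w \<noteq> s"
    using w(3) gdist_refl[of "H k" s] by (auto simp: \<open>s' = s\<close>)
  then have "w \<notin> verts (chain_graph (k - 1) H)"
    using s(1) w(2) by (metis IntI singletonD)
  with w \<open>s' = s\<close> show ?thesis
    by (intro that) auto
qed

lemma deg_chain:
  assumes chain: "spiro_chain n l H" and k: "2 \<le> k" "k \<le> n"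
    and s: "verts (chain_graph (k - 1) H) \<inter> verts (H k) = {s}"
  shows "deg (chain_graph k H) v = deg (chain_graph (k - 1) H) v + deg (H k) v"
proof -
  have "hexagon (H k)" "simple_graph (chain_graph (k - 1) H)"
    using k spiro_chain_hexagon[OF chain] simple_graph_chain[OF chain] by auto
  moreover have "chain_graph k H = graph_join (chain_graph (k - 1) H) (H k)"
    using k by (simp add: chain_graph_pred)
  ultimately show ?thesis
    using deg_join[OF _ hexagon_simple s] by simp
qed

text \<open>By induction along the chain, an attachment vertex lies in only one of the earlier hexagons, so
  it has degree 2 before the next hexagon is attached.\<close>

lemma attachment_vertex:
  assumes chain: "spiro_chain n l H" and l: "\<forall>k\<in>{3..n}. l k \<noteq> 0"
    and k: "2 \<le> k" "k \<le> n"
  shows "\<exists>w. verts (chain_graph (k - 1) H) \<inter> verts (H k) = {w} \<and> w \<in> verts (H (k - 1))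
    \<and> deg (chain_graph (k - 1) H) w = 2"
  using k
proof (induction k rule: dec_induct)
  case base
  then obtain w where w: "verts (H 1) \<inter> verts (H 2) = {w}"
    using chain by (auto simp: spiro_chain_def)
  then have "w \<in> verts (H 1)"
    by (metis IntD1 insertI1)
  moreover have "deg (H 1) w = 2"
    using \<open>w \<in> verts (H 1)\<close> base spiro_chain_hexagon[OF chain] by (intro hexagon_deg) auto
  moreover have "chain_graph (2 - 1) H = H 1"
    using chain_graph_1[of H] by simp
  ultimately show ?case
    using w by (intro exI[of _ w]) simp
next
  case (step k)
  then obtain s where s: "verts (chain_graph (k - 1) H) \<inter> verts (H k) = {s}" "s \<in> verts (H (k - 1))"
    by auto
  have "Suc k \<le> n" "k \<le> n" using step by auto
  obtain w where w: "w \<in> verts (H k)" "w \<notin> verts (chain_graph (k - 1) H)"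
      "verts (chain_graph k H) \<inter> verts (H (Suc k)) = {w}"
    using next_attachment[OF chain l \<open>2 \<le> k\<close> \<open>Suc k \<le> n\<close> s] .
  have hex: "hexagon (H k)" and simple: "simple_graph (chain_graph (k - 1) H)"
    using step spiro_chain_hexagon[OF chain] simple_graph_chain[OF chain] by auto
  have "deg (chain_graph k H) w = 2"
    using deg_chain[OF chain \<open>2 \<le> k\<close> \<open>k \<le> n\<close> s(1), of w] deg_eq_0[OF simple w(2)] hexagon_deg[OF hex w(1)]
    by simp
  with w(1,3) show ?case
    by (intro exI[of _ w]) simp
qed

text \<open>Here \<open>w\<close> is the vertex at which \<open>H (k + 1)\<close> is attached, and \<open>s\<close> the one at which \<open>H k\<close> was
  attached. All neighbours of \<open>w\<close> lie in \<open>H k\<close>, whose only vertex shared with earlier hexagons is \<open>s\<close>.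
  The neighbours see no difference between the distances 2 and 3: in both cases they have degree 2.\<close>

lemma attachment_neighbours:
  assumes chain: "spiro_chain n l H" and l: "\<forall>k\<in>{3..n}. l k \<noteq> 0"
    and k: "2 \<le> k" "Suc k \<le> n"
  obtains s w where "verts (chain_graph k H) \<inter> verts (H (Suc k)) = {w}"
    "deg (chain_graph k H) w = 2" "deg (chain_graph k H) s = 4"
    "\<And>u. u \<in> nbrs (chain_graph k H) w \<Longrightarrow> u \<noteq> s \<Longrightarrow> deg (chain_graph k H) u = 2"
    "s \<in> nbrs (chain_graph k H) w \<longleftrightarrow> l (Suc k) = 1"
proof -
  obtain s where s: "verts (chain_graph (k - 1) H) \<inter> verts (H k) = {s}" "s \<in> verts (H (k - 1))"
      "deg (chain_graph (k - 1) H) s = 2"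
    using attachment_vertex[OF chain l, of k] k by auto
  obtain w where w: "w \<in> verts (H k)" "w \<notin> verts (chain_graph (k - 1) H)"
      "gdist (H k) s w = l (Suc k)" "verts (chain_graph k H) \<inter> verts (H (Suc k)) = {w}"
    using next_attachment[OF chain l k s(1,2)] .
  have hex: "hexagon (H k)" and simple: "simple_graph (chain_graph (k - 1) H)"
    using k spiro_chain_hexagon[OF chain] simple_graph_chain[OF chain] by auto
  have deg: "deg (chain_graph k H) v = deg (chain_graph (k - 1) H) v + deg (H k) v" for v
    using k s(1) by (intro deg_chain[OF chain]) auto
  have sH: "s \<in> verts (H k)"
    using s(1) by (metis IntD2 insertI1)
  have "chain_graph k H = graph_join (chain_graph (k - 1) H) (H k)"
    using k by (simp add: chain_graph_pred)
  then have nbrs: "u \<in> nbrs (chain_graph k H) w \<longleftrightarrow> {w, u} \<in> edges (H k)" for u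
    using nbrs_eq_empty[OF simple w(2)] by (auto simp: nbrs_def graph_join_def)
  show ?thesis
  proof
    show "verts (chain_graph k H) \<inter> verts (H (Suc k)) = {w}" by fact
    show "deg (chain_graph k H) w = 2"
      using deg_eq_0[OF simple w(2)] hexagon_deg[OF hex w(1)] by (simp add: deg)
    show "deg (chain_graph k H) s = 4"
      using s(3) hexagon_deg[OF hex sH] by (simp add: deg)
    show "deg (chain_graph k H) u = 2" if "u \<in> nbrs (chain_graph k H) w" "u \<noteq> s" for u
    proof -
      have u: "u \<in> verts (H k)"
        using that(1) simple_graph_edgeD(2)[OF hexagon_simple[OF hex]] by (simp add: nbrs)
      then have "u \<notin> verts (chain_graph (k - 1) H)"
        using s(1) that(2) by (metis IntI singletonD)
      then show ?thesis
        using deg_eq_0[OF simple] hexagon_deg[OF hex u] by (simp add: deg)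
    qed
    show "s \<in> nbrs (chain_graph k H) w \<longleftrightarrow> l (Suc k) = 1"
      using hexagon_gdist_eq_1[OF hex sH w(1)] w(3) by (simp add: nbrs insert_commute)
  qed
qed

section \<open>The index of a spiro chain\<close>

lemma vertex_index_spiro_chain:
  assumes chain: "spiro_chain n l H" and l: "\<forall>k\<in>{3..n}. l k \<noteq> 0" and n: "1 \<le> n"
  shows "vertex_index h a (chain_graph n H)
    = 6 * h 2 powr a + (real n - 1) * (4 * h 2 powr a + h 4 powr a)"
proof -
  have "vertex_index h a (chain_graph m H)
      = 6 * h 2 powr a + (real m - 1) * (4 * h 2 powr a + h 4 powr a)" if "1 \<le> m" "m \<le> n" for m
    using that
  proof (induction m rule: dec_induct)
    case base
    then have "hexagon (H 1)"
      using spiro_chain_hexagon[OF chain] by simp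
    then show ?case
      unfolding chain_graph_1 by (simp add: vertex_index_hexagon)
  next
    case (step m)
    then obtain w where "verts (chain_graph m H) \<inter> verts (H (Suc m)) = {w}"
        "deg (chain_graph m H) w = 2"
      using attachment_vertex[OF chain l, of "Suc m"] by auto
    moreover have "simple_graph (chain_graph m H)" "hexagon (H (Suc m))"
      using step simple_graph_chain[OF chain] spiro_chain_hexagon[OF chain] by auto
    ultimately show ?case
      using step by (simp add: chain_graph_Suc vertex_index_join algebra_simps)
  qed
  then show ?thesis using n by simp
qed

text \<open>The constant \<open>c\<close> is the index of two hexagons sharing a vertex: of the twelve edges, four are
  incident to that vertex of degree 4. In \<open>\<delta>\<close>, the six new edges give \<open>4 * g 2 2 + 2 * g 2 4\<close>. At
  distance 1 the two old edges at the attachment vertex change from joining degrees 2 and 4, and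
  2 and 2, to joining 4 and 4, and 4 and 2, a gain of \<open>g 4 4 - g 2 2\<close>. At larger distances both
  change from \<open>g 2 2\<close> to \<open>g 2 4\<close>.\<close>

lemma edge_index_spiro_chain:
  fixes f a
  defines "g d d' \<equiv> f d d' powr a"
  defines "c \<equiv> 8 * g 2 2 + 4 * g 2 4"
    and "\<delta> i \<equiv> (if i = 1 then 3 * g 2 2 + 2 * g 2 4 + g 4 4 else 2 * g 2 2 + 4 * g 2 4)"
  assumes chain: "spiro_chain n l H" and l: "\<forall>k\<in>{3..n}. l k \<noteq> 0" and n: "2 \<le> n"
    and sym: "\<And>d d'. d \<ge> 1 \<Longrightarrow> d' \<ge> 1 \<Longrightarrow> f d d' = f d' d"
  shows "edge_index f a (chain_graph n H) = c + (\<Sum>k = 3..n. \<delta> (l k))"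
proof -
  have g: "g 4 2 = g 2 4"
    using sym[of 4 2] by (simp add: g_def)
  have join: "edge_index f a (chain_graph (Suc m) H) = edge_index f a (chain_graph m H)
      + (4 * g 2 2 + 2 * g 2 4)
      + (\<Sum>u\<in>nbrs (chain_graph m H) w.
          g 4 (deg (chain_graph m H) u) - g 2 (deg (chain_graph m H) u))"
    if "1 \<le> m" "Suc m \<le> n" "verts (chain_graph m H) \<inter> verts (H (Suc m)) = {w}"
      "deg (chain_graph m H) w = 2" for m w
    unfolding g_def chain_graph_Suc[OF that(1)]
    using that simple_graph_chain[OF chain] spiro_chain_hexagon[OF chain] sym
    by (intro edge_index_join) auto
  have card_nbrs: "card (nbrs (chain_graph m H) w) = 2"
    if "1 \<le> m" "Suc m \<le> n" "deg (chain_graph m H) w = 2" for m w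
    using that simple_graph_chain[OF chain, of m] by (simp flip: deg_eq_card_nbrs)
  have "edge_index f a (chain_graph m H) = c + (\<Sum>k = 3..m. \<delta> (l k))" if "2 \<le> m" "m \<le> n" for m
    using that
  proof (induction m rule: dec_induct)
    case base
    have two: "Suc 1 = 2" by simp
    have hex: "hexagon (H 1)"
      using base spiro_chain_hexagon[OF chain] by simp
    obtain w where w: "verts (chain_graph 1 H) \<inter> verts (H 2) = {w}" "deg (chain_graph 1 H) w = 2"
      using attachment_vertex[OF chain l, of 2] base by auto
    have "deg (H 1) u = 2" if "u \<in> nbrs (H 1) w" for u
      using that nbrs_subset[OF hexagon_simple[OF hex], of w] by (intro hexagon_deg[OF hex]) blast
    then have "(\<Sum>u\<in>nbrs (H 1) w. g 4 (deg (H 1) u) - g 2 (deg (H 1) u))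
        = (\<Sum>u\<in>nbrs (H 1) w. g 4 2 - g 2 2)"
      by (intro sum.cong) simp_all
    also have "\<dots> = 2 * (g 2 4 - g 2 2)"
      using card_nbrs[of 1 w] w base g unfolding chain_graph_1 by simp
    finally have "edge_index f a (chain_graph 2 H) = 6 * g 2 2 + (4 * g 2 2 + 2 * g 2 4)
        + 2 * (g 2 4 - g 2 2)"
      using join[of 1 w, unfolded two] w base edge_index_hexagon[OF hex sym]
      unfolding chain_graph_1 g_def by simp
    then show ?case by (simp add: c_def)
  next
    case (step m)
    let ?G = "chain_graph m H"
    obtain s w where w: "verts ?G \<inter> verts (H (Suc m)) = {w}" "deg ?G w = 2" and s: "deg ?G s = 4"
      and other: "\<And>u. u \<in> nbrs ?G w \<Longrightarrow> u \<noteq> s \<Longrightarrow> deg ?G u = 2"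
      and adj: "s \<in> nbrs ?G w \<longleftrightarrow> l (Suc m) = 1"
      using attachment_neighbours[OF chain l step.hyps(1) step.prems] by metis
    have card: "card (nbrs ?G w) = 2"
      using card_nbrs[of m w] step w by simp
    then have fin: "finite (nbrs ?G w)"
      by (metis card.infinite zero_neq_numeral)
    \<comment> \<open>The neighbour \<open>s\<close> of degree 4, if it is one, is split off from the neighbours of degree 2.\<close>
  have off: "(\<Sum>u\<in>nbrs ?G w - {s}. g 4 (deg ?G u) - g 2 (deg ?G u))
        = real (card (nbrs ?G w - {s})) * (g 2 4 - g 2 2)"
      using other g by simp
    have "(\<Sum>u\<in>nbrs ?G w. g 4 (deg ?G u) - g 2 (deg ?G u)) =
        (if l (Suc m) = 1 then g 4 4 - g 2 2 else 2 * (g 2 4 - g 2 2))"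
    proof (cases "s \<in> nbrs ?G w")
      case True
      then show ?thesis
        using off fin card adj s by (simp add: sum.remove)
    next
      case False
      then show ?thesis
        using off card adj by simp
    qed
    then have "edge_index f a (chain_graph (Suc m) H) = edge_index f a ?G + \<delta> (l (Suc m))"
      using join[of m w] w step by (simp add: \<delta>_def)
    then show ?case
      using step by simp
  qed
  then show ?thesis using n by simp
qed

text \<open>The constants do not depend on \<open>n\<close>, \<open>l\<close> and \<open>H\<close>, so they can be read off from any chains of two
  and of three hexagons.\<close>

lemma topological_index_spiro_chain:
  fixes TI :: "'a sgraph \<Rightarrow> real"
  assumes "topological_index a TI"
  obtains c \<delta> where "\<And>n l H. 2 \<le> n \<Longrightarrow> spiro_chain n l H \<Longrightarrow> \<forall>k\<in>{3..n}. l k \<noteq> 0 \<Longrightarrow>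
    TI (chain_graph n H) = c + (\<Sum>k = 3..n. \<delta> (l k))"
  using assms unfolding topological_index_def
proof (elim disjE exE conjE)
  fix h assume TI: "TI = vertex_index h a"
  show thesis
  proof (rule that)
    fix n l and H :: "nat \<Rightarrow> 'a sgraph"
    assume "2 \<le> n" "spiro_chain n l H" "\<forall>k\<in>{3..n}. l k \<noteq> 0"
    then show "TI (chain_graph n H) = (10 * h 2 powr a + h 4 powr a)
        + (\<Sum>k = 3..n. (\<lambda>_. 4 * h 2 powr a + h 4 powr a) (l k))"
      by (simp add: TI vertex_index_spiro_chain algebra_simps of_nat_diff)
  qed
next
  fix f assume "\<forall>d\<ge>1. \<forall>d'\<ge>1. 0 < f d d' \<and> f d d' = f d' d" and TI: "TI = edge_index f a"
  then have sym: "\<And>d d'. d \<ge> 1 \<Longrightarrow> d' \<ge> 1 \<Longrightarrow> f d d' = f d' d"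
    by blast
  let ?g = "\<lambda>d d'. f d d' powr a"
  show thesis
  proof (rule that)
    fix n l and H :: "nat \<Rightarrow> 'a sgraph"
    assume "2 \<le> n" "spiro_chain n l H" "\<forall>k\<in>{3..n}. l k \<noteq> 0"
    then show "TI (chain_graph n H) = (8 * ?g 2 2 + 4 * ?g 2 4) + (\<Sum>k = 3..n.
        (\<lambda>i. if i = 1 then 3 * ?g 2 2 + 2 * ?g 2 4 + ?g 4 4 else 2 * ?g 2 2 + 4 * ?g 2 4) (l k))"
      unfolding TI using sym by (intro edge_index_spiro_chain) auto
  qed
qed

section \<open>Expectation and variance\<close>

theorem theorem1:
  fixes M :: "'w measure"
    and n :: nat
    and p :: "nat \<Rightarrow> real"
    and L :: "nat \<Rightarrow> 'w \<Rightarrow> nat"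
    and H :: "nat \<Rightarrow> 'w \<Rightarrow> 'a sgraph"
    and a :: real
    and TI :: "'a sgraph \<Rightarrow> real"
    and l :: "nat \<Rightarrow> nat"
    and C2 :: "nat \<Rightarrow> 'a sgraph"
    and C3 :: "nat \<Rightarrow> nat \<Rightarrow> 'a sgraph"
  assumes "topological_index a TI"
    and "2 \<le> n"
    and "random_spiro_chain M n p L H"
    and "spiro_chain 2 l C2"
    and "\<And>i. i \<in> {1..3} \<Longrightarrow> spiro_chain 3 (\<lambda>_. i) (C3 i)"
  defines "TI_n \<equiv> \<lambda>\<omega>. TI (chain_graph n (\<lambda>k. H k \<omega>))"
    and "TI_2 \<equiv> TI (chain_graph 2 C2)"
    and "TI_3 \<equiv> \<lambda>i. TI (chain_graph 3 (C3 i))"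
  defines "\<alpha>i \<equiv> \<lambda>i. TI_3 i - TI_2"
  defines "\<alpha> \<equiv> \<Sum>i = 1..3. \<alpha>i i * p i"
    and "\<beta> \<equiv> \<Sum>i = 1..3. (\<alpha>i i)\<^sup>2 * p i"
  shows "prob_space.expectation M TI_n = TI_2 + \<alpha> * (real n - 2) \<and>
         prob_space.variance M TI_n = (\<beta> - \<alpha>\<^sup>2) * (real n - 2)"
proof -
  interpret random_spiro_chain M n p L H by fact
  obtain c \<delta> where TI: "\<And>n l H. 2 \<le> n \<Longrightarrow> spiro_chain n l H \<Longrightarrow> \<forall>k\<in>{3..n}. l k \<noteq> 0 \<Longrightarrow>
      TI (chain_graph n H) = c + (\<Sum>k = 3..n. \<delta> (l k))"
    using topological_index_spiro_chain[OF assms(1)] by metis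
  have TI_2: "TI_2 = c"
    using TI[OF _ assms(4)] by (simp add: TI_2_def)
  have \<alpha>i: "\<alpha>i i = \<delta> i" if "i \<in> {1..3}" for i
    using TI[OF _ assms(5)[OF that]] that by (simp add: \<alpha>i_def TI_3_def TI_2)
  have L: "L k \<in> measurable M (count_space {1..3})" if "k \<in> {3..n}" for k
    using choices_indep that by (simp add: indep_vars_def)
  have law: "integrable M (\<lambda>\<omega>. F (L k \<omega>))"
    "expectation (\<lambda>\<omega>. F (L k \<omega>)) = (\<Sum>i = 1..3. F i * p i)"
    if "k \<in> {3..n}" for k and F :: "nat \<Rightarrow> real"
    using finite_valued_distribution[OF _ L[OF that] choices_prob[OF that]] by auto
  have TI_n: "TI_n \<omega> = c + (\<Sum>k = 3..n. \<delta> (L k \<omega>))" if "\<omega> \<in> space M" for \<omega>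
    unfolding TI_n_def
    using measurable_space[OF L that] by (intro TI assms(2) chain that) force
  have int: "integrable M (\<lambda>\<omega>. \<delta> (L k \<omega>))" "integrable M (\<lambda>\<omega>. (\<delta> (L k \<omega>))\<^sup>2)"
    if "k \<in> {3..n}" for k
    using law(1)[OF that, of \<delta>] law(1)[OF that, of "\<lambda>i. (\<delta> i)\<^sup>2"] by auto
  have mean: "expectation (\<lambda>\<omega>. \<delta> (L k \<omega>)) = \<alpha>" if "k \<in> {3..n}" for k
    using law(2)[OF that, of \<delta>] \<alpha>i by (simp add: \<alpha>_def)
  have var: "variance (\<lambda>\<omega>. \<delta> (L k \<omega>)) = \<beta> - \<alpha>\<^sup>2" if "k \<in> {3..n}" for k
    using law(2)[OF that, of "\<lambda>i. (\<delta> i)\<^sup>2"] \<alpha>i variance_eq[OF int[OF that]] mean[OF that]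
    by (simp add: \<beta>_def)
  have indep: "indep_vars (\<lambda>_. borel) (\<lambda>k \<omega>. \<delta> (L k \<omega>)) {3..n}"
    using choices_indep by (rule indep_vars_compose2) simp
  have n: "real (card {3..n}) = real n - 2"
    using assms(2) by simp
  let ?S = "\<lambda>\<omega>. \<Sum>k = 3..n. \<delta> (L k \<omega>)"
  have "expectation ?S = (\<Sum>k = 3..n. expectation (\<lambda>\<omega>. \<delta> (L k \<omega>)))"
    using int(1) by (rule Bochner_Integration.integral_sum)
  also have "\<dots> = (\<Sum>k = 3..n. \<alpha>)"
    using mean by (rule sum.cong[OF refl])
  finally have mean_S: "expectation ?S = \<alpha> * (real n - 2)"
    using n by simp
  have "variance ?S = (\<Sum>k = 3..n. variance (\<lambda>\<omega>. \<delta> (L k \<omega>)))"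
    using int by (intro variance_sum_indep indep) auto
  also have "\<dots> = (\<Sum>k = 3..n. \<beta> - \<alpha>\<^sup>2)"
    using var by (rule sum.cong[OF refl])
  finally have var_S: "variance ?S = (\<beta> - \<alpha>\<^sup>2) * (real n - 2)"
    using n by simp
  have int_S: "integrable M ?S"
    using int(1) by (rule Bochner_Integration.integrable_sum)
  have "expectation TI_n = expectation (\<lambda>\<omega>. c + ?S \<omega>)"
    using TI_n by (rule Bochner_Integration.integral_cong[OF refl])
  also have "\<dots> = c + expectation ?S"
    using int_S by (simp add: prob_space)
  finally have mean_TI: "expectation TI_n = c + expectation ?S" .
  have "variance TI_n = variance ?S"
    unfolding mean_TI using TI_n by (intro Bochner_Integration.integral_cong) auto
  with mean_TI mean_S var_S show ?thesis
    by (simp add: TI_2)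
qed

end
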